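(* Let $\Omega\subset\mathbb{R}^n$ be a convex domain, let $a^{ij}:\mathbb{R}^n\to\mathbb{R}$ ($i,j=1,\dots,n$) be measurable and let $b:\Omega\times\mathbb{R}\times\mathbb{R}^n\to\mathbb{R}$ be differentiable in its second variable. Assume that the matrix $[a^{ij}(\xi)]_{i,j}$ is symmetric and positive definite for all $\xi\in\mathbb{R}^n$. Let $u\in C^2(\Omega)\cap C(\overline\Omega)$ be a solution of $$\sum_{i,j=1}^n a^{ij}(Du)\,\partial^2_{ij}u-b(x,u,Du)=0\quad\text{in }\Omega,$$ and set $M:=\|u\|_{C^2(\Omega)}$, $m:=\|u\|_{L^\infty(\Omega)}$. Assume that for some $\delta\ge 0$ and $\beta>0$ $$\partial_s b(x,s,z)\ge\beta\quad\text{for all }(x,s,z)\in\Omega\times[-m,m]\times\overline B_M,$$ and that $$\mathcal{HC}_{b(\cdot,u(\cdot),z)}(x_1,x_3,\lambda)\ge-\delta$$ for all $z\in\overline B_M$ and all $(x_1,x_3,\lambda)\in\Omega\times\Omega\times[0,1]$ for which either $(1-\lambda)b(x_1,u(x_1),z)+\lambda b(x_3,u(x_3),z)>0$ or $b(x_1,u(x_1),z)=b(x_3,u(x_3),z)=0$. If $\mathcal C_u$ achieves a positive interior maximum in $\Omega\times\Omega\times[0,1]$, then there exist a convex function $v:\Omega\to\mathbb{R}$ and a constant $k_n>0$, depending only on $n$, such that $$\|u-v\|_{L^\infty(\Omega)}\le\frac{k_n}{\beta}\,\delta.$$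
   Context: A domain is a connected open set. For $u:\overline\Omega\to\mathbb{R}$, $y_1,y_3\in\overline\Omega$, $\lambda\in[0,1]$, the convexity function is $$\mathcal C_u(y_1,y_3,\lambda):=u(\lambda y_1+(1-\lambda)y_3)-\lambda u(y_1)-(1-\lambda)u(y_3).$$ "$\mathcal C_u$ achieves a positive interior maximum in $\Omega\times\Omega\times[0,1]$" means that $\mathcal C_u$ attains its maximum at some $(x_1,x_3,\lambda)$ with $x_1,x_3\in\Omega$ (hence also $\lambda x_1+(1-\lambda)x_3\in\Omega$), $\lambda\in[0,1]$, and that the maximum value is positive. For fixed $z$, write $b_i:=b(x_i,u(x_i),z)$ for $i=1,3$, and $x_2:=\lambda x_1+(1-\lambda)x_3$, $s_2:=\lambda u(x_1)+(1-\lambda)u(x_3)$. The harmonic convexity function of $b(\cdot,\cdot,z)$ along $u$ is $$\mathcal{HC}_{b(\cdot,u(\cdot),z)}(x_1,x_3,\lambda):=\begin{cases} b(x_2,s_2,z)-\dfrac{b_1b_3}{(1-\lambda)b_1+\lambda b_3}&\text{if }(1-\lambda)b_1+\lambda b_3>0,\\[2mm] b(x_2,s_2,z)&\text{if }b_1=b_3=0,\end{cases}$$ and it is not defined otherwise. $\overline B_M$ is the closed ball of radius $M$ centered at $0$ in $\mathbb{R}^n$ (read as $\mathbb{R}^n$ if $M=\infty$; likewise $[-m,m]$ is read as $\mathbb{R}$ if $m=\infty$). *)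

theory Defs
  imports "HOL-Analysis.Analysis" "HOL-Probability.Essential_Supremum"
begin

definition is_domain :: "'a::topological_space set \<Rightarrow> bool" where
  "is_domain \<Omega> \<longleftrightarrow> open \<Omega> \<and> connected \<Omega>"

definition pderiv_at :: "'n::finite \<Rightarrow> (real^'n \<Rightarrow> real) \<Rightarrow> real^'n \<Rightarrow> real" where
  "pderiv_at i f x = deriv (\<lambda>t. f (x + t *\<^sub>R axis i 1)) 0"

definition has_pderiv_at :: "'n::finite \<Rightarrow> (real^'n \<Rightarrow> real) \<Rightarrow> real^'n \<Rightarrow> bool" where
  "has_pderiv_at i f x \<longleftrightarrow> (\<lambda>t. f (x + t *\<^sub>R axis i 1)) field_differentiable (at 0)"

text \<open>Functions of class \<open>C\<^sup>k\<close> on an open set, by iterated continuous partial derivatives.\<close>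

primrec Ck_on :: "nat \<Rightarrow> (real^'n::finite) set \<Rightarrow> (real^'n \<Rightarrow> real) \<Rightarrow> bool" where
  "Ck_on 0 S f \<longleftrightarrow> continuous_on S f"
| "Ck_on (Suc k) S f \<longleftrightarrow> continuous_on S f \<and>
     (\<forall>i. (\<forall>x\<in>S. has_pderiv_at i f x) \<and> Ck_on k S (pderiv_at i f))"

definition grad :: "(real^'n::finite \<Rightarrow> real) \<Rightarrow> real^'n \<Rightarrow> real^'n" where
  "grad f x = (\<chi> i. pderiv_at i f x)"

definition hessian :: "(real^'n::finite \<Rightarrow> real) \<Rightarrow> real^'n \<Rightarrow> real^'n^'n" where
  "hessian f x = (\<chi> i j. pderiv_at i (pderiv_at j f) x)"

text \<open>
  The norms are extended reals because they may be infinite.  In \<open>C2_norm\<close> the gradient is measured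
  in the Euclidean norm and the Hessian in the operator norm; the result is at most the sum of the
  suprema of all partial derivatives of order at most 2.
\<close>

definition C2_norm :: "(real^'n::finite) set \<Rightarrow> (real^'n \<Rightarrow> real) \<Rightarrow> ereal" where
  "C2_norm \<Omega> f = (SUP x\<in>\<Omega>. ereal \<bar>f x\<bar>) + (SUP x\<in>\<Omega>. ereal (norm (grad f x)))
     + (SUP x\<in>\<Omega>. ereal (onorm ((*v) (hessian f x))))"

definition Linf_norm :: "'a::euclidean_space set \<Rightarrow> ('a \<Rightarrow> real) \<Rightarrow> ereal" where
  "Linf_norm \<Omega> f = esssup (lebesgue_on \<Omega>) (\<lambda>x. ereal \<bar>f x\<bar>)"

definition symmetric_matrix :: "real^'n^'n::finite \<Rightarrow> bool" where
  "symmetric_matrix A \<longleftrightarrow> transpose A = A"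

definition positive_definite :: "real^'n^'n::finite \<Rightarrow> bool" where
  "positive_definite A \<longleftrightarrow> (\<forall>v. v \<noteq> 0 \<longrightarrow> v \<bullet> (A *v v) > 0)"

definition convexity_fun :: "('a::real_vector \<Rightarrow> real) \<Rightarrow> 'a \<Rightarrow> 'a \<Rightarrow> real \<Rightarrow> real" where
  "convexity_fun u y1 y3 t = u (t *\<^sub>R y1 + (1 - t) *\<^sub>R y3) - t * u y1 - (1 - t) * u y3"

definition achieves_pos_interior_max :: "('a::real_normed_vector) set \<Rightarrow> ('a \<Rightarrow> real) \<Rightarrow> bool" where
  "achieves_pos_interior_max \<Omega> u \<longleftrightarrow>
     (\<exists>x1\<in>\<Omega>. \<exists>x3\<in>\<Omega>. \<exists>t\<in>{0..1}.
        convexity_fun u x1 x3 t > 0 \<and>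
        (\<forall>y1\<in>closure \<Omega>. \<forall>y3\<in>closure \<Omega>. \<forall>\<mu>\<in>{0..1}.
           convexity_fun u y1 y3 \<mu> \<le> convexity_fun u x1 x3 t))"

definition harmonic_convexity_defined ::
  "('a \<Rightarrow> real \<Rightarrow> 'b \<Rightarrow> real) \<Rightarrow> ('a \<Rightarrow> real) \<Rightarrow> 'b \<Rightarrow> 'a \<Rightarrow> 'a \<Rightarrow> real \<Rightarrow> bool" where
  "harmonic_convexity_defined b u z x1 x3 t \<longleftrightarrow>
     (1 - t) * b x1 (u x1) z + t * b x3 (u x3) z > 0 \<or>
     (b x1 (u x1) z = 0 \<and> b x3 (u x3) z = 0)"

text \<open>Only meaningful where \<open>harmonic_convexity_defined\<close> holds.\<close>

definition harmonic_convexity_fun ::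
  "('a::real_vector \<Rightarrow> real \<Rightarrow> 'b \<Rightarrow> real) \<Rightarrow> ('a \<Rightarrow> real) \<Rightarrow> 'b \<Rightarrow> 'a \<Rightarrow> 'a \<Rightarrow> real \<Rightarrow> real" where
  "harmonic_convexity_fun b u z x1 x3 t =
     (let b1 = b x1 (u x1) z;
          b3 = b x3 (u x3) z;
          x2 = t *\<^sub>R x1 + (1 - t) *\<^sub>R x3;
          s2 = t * u x1 + (1 - t) * u x3
      in if (1 - t) * b1 + t * b3 > 0
           then b x2 s2 z - b1 * b3 / ((1 - t) * b1 + t * b3)
         else if b1 = 0 \<and> b3 = 0 then b x2 s2 z
         else undefined)"

end

theory Submission
  imports Defs
begin

text \<open>
  The proof has two independent halves: the maximum \<open>\<epsilon>\<close> of the convexity function is at most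
  \<open>\<delta> / \<beta>\<close>, and a function whose convexity function is bounded by \<open>\<epsilon>\<close> lies within a dimensional
  multiple of \<open>\<epsilon>\<close> of a convex function (the Hyers--Ulam theorem, \<open>Hyers_Ulam_approx_convex\<close>).

  For the first half, let the maximum be attained at \<open>(x1, x3, t)\<close> and let \<open>x2\<close> be the intermediate
  point.  The first-order conditions say that \<open>u\<close> has the same gradient \<open>z\<close> at the three points, so
  the coefficient matrix \<open>A = a(z)\<close> of the equation is the same at all of them.  Moving \<open>x1\<close> by
  \<open>\<alpha> h\<close> and \<open>x3\<close> by \<open>\<gamma> h\<close>, the second-order condition compares the three Hessians as quadratic
  forms in \<open>h\<close>, with weights depending on \<open>\<alpha>\<close> and \<open>\<gamma>\<close> (\<open>convexity_fun_interior_max\<close>).  Pairing with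
  the positive definite \<open>A\<close> preserves the comparison (\<open>trace_pairing_mono\<close>), and the equation turns
  the pairings into the values \<open>b1, b2, b3\<close> of \<open>b\<close> along \<open>u\<close>:
  \<open>(t \<alpha> + (1 - t) \<gamma>)\<^sup>2 b2 \<le> t \<alpha>\<^sup>2 b1 + (1 - t) \<gamma>\<^sup>2 b3\<close> for all real \<open>\<alpha>, \<gamma>\<close>.  Optimizing over
  \<open>\<alpha>, \<gamma>\<close> yields exactly the alternatives in the definition of the harmonic convexity function:
  either \<open>b2\<close> is at most the weighted harmonic mean of \<open>b1\<close> and \<open>b3\<close>, or \<open>b1 = b3 = 0\<close> and
  \<open>b2 \<le> 0\<close> (\<open>harmonic_bound_of_quadratic\<close>).  In both cases replacing \<open>u(x2)\<close> by the interpolated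
  value \<open>s2\<close> lowers \<open>b(x2, _, z)\<close> by at most \<open>\<delta>\<close>, while it lowers it by at least
  \<open>\<beta> (u(x2) - s2) = \<beta> \<epsilon>\<close>.

  For the second half, the convex function is the lower boundary of the convex hull of the epigraph
  of \<open>u\<close>.  By Caratheodory's theorem in the space of dimension \<open>n + 1\<close> its values come from convex
  combinations of at most \<open>n + 2\<close> points of the epigraph, and each point in such a combination costs
  at most one \<open>\<epsilon>\<close>.  This gives \<open>k = n + 2\<close>.
\<close>

section \<open>Second-order calculus along lines\<close>

lemma has_pderiv_at_along_axis:
  assumes "has_pderiv_at i f (x + t *\<^sub>R axis i 1)"
  shows "((\<lambda>t. f (x + t *\<^sub>R axis i 1)) has_real_derivative
           pderiv_at i f (x + t *\<^sub>R axis i 1)) (at t)"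
proof -
  have "((\<lambda>s. f ((x + t *\<^sub>R axis i 1) + s *\<^sub>R axis i 1)) has_real_derivative
           pderiv_at i f (x + t *\<^sub>R axis i 1)) (at 0)"
    using assms unfolding has_pderiv_at_def pderiv_at_def
    by (rule field_differentiable_derivI)
  then have "((\<lambda>s. f (x + (s + t) *\<^sub>R axis i 1)) has_real_derivative
           pderiv_at i f (x + t *\<^sub>R axis i 1)) (at 0)"
    by (simp add: algebra_simps)
  then show ?thesis
    using DERIV_shift[of "\<lambda>s. f (x + s *\<^sub>R axis i 1)" _ 0 t] by simp
qed

text \<open>
  The coordinates of the increment are switched on one at a time, so that each new one is a
  one-dimensional mean value estimate controlled by the continuity at \<open>x\<close> of a single partial
  derivative.  For \<open>I = UNIV\<close> this is differentiability at \<open>x\<close>.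
\<close>

lemma C1_partial_increment:
  fixes f :: "real^'n::finite \<Rightarrow> real"
  assumes S: "open S" "x \<in> S"
    and ex: "\<And>i y. y \<in> S \<Longrightarrow> has_pderiv_at i f y"
    and cont: "\<And>i. continuous_on S (pderiv_at i f)"
    and "e > 0"
  shows "\<exists>d>0. \<forall>h. norm h < d \<longrightarrow>
           \<bar>f (x + (\<chi> i. if i \<in> I then h$i else 0)) - f x - (\<Sum>i\<in>I. h$i * pderiv_at i f x)\<bar>
             \<le> e * norm h"
proof -
  have "finite I" by simp
  then show ?thesis using \<open>e > 0\<close>
  proof (induction I arbitrary: e rule: finite_induct)
    case empty
    have "(\<chi> i. 0) = (0 :: real^'n)" by (simp add: vec_eq_iff)
    then show ?case using empty by (intro exI[of _ 1]) simp
  next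
    case (insert k I)
    define R where "R J h = (\<chi> i. if i \<in> J then h$i else 0)" for J and h :: "real^'n"
    obtain d1 where d1: "d1 > 0" "\<And>h. norm h < d1 \<Longrightarrow>
        \<bar>f (x + R I h) - f x - (\<Sum>i\<in>I. h$i * pderiv_at i f x)\<bar> \<le> e / 2 * norm h"
      using insert.IH[of "e / 2"] insert.prems unfolding R_def by auto
    have "isCont (pderiv_at k f) x"
      using cont[of k] S continuous_on_eq_continuous_at by blast
    then obtain d2 where d2: "d2 > 0" "\<And>y. dist y x < d2 \<Longrightarrow>
        \<bar>pderiv_at k f y - pderiv_at k f x\<bar> < e / 2"
      using insert.prems unfolding continuous_at_eps_delta dist_real_def
      by (metis half_gt_zero)
    obtain d3 where d3: "d3 > 0" "ball x d3 \<subseteq> S"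
      using S openE by blast
    have main: "\<bar>f (x + R (insert k I) h) - f x - (\<Sum>i\<in>insert k I. h$i * pderiv_at i f x)\<bar>
        \<le> e * norm h" if h: "norm h < min d1 (min d2 d3)" for h
    proof -
      define g where "g t = f ((x + R I h) + t *\<^sub>R axis k 1) - t * pderiv_at k f x" for t
      let ?p = "\<lambda>t. (x + R I h) + t *\<^sub>R axis k 1"
      have step: "R (insert k I) h = R I h + h$k *\<^sub>R axis k 1"
        using insert.hyps by (auto simp: R_def vec_eq_iff axis_def)
      have near: "dist (?p t) x < min d2 d3" if "\<bar>t\<bar> \<le> \<bar>h$k\<bar>" for t
      proof -
        have "norm (R I h + t *\<^sub>R axis k 1) \<le> norm h"
          using that insert.hyps
          by (intro norm_le_componentwise_cart) (auto simp: R_def axis_def)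
        then show ?thesis using h by (simp add: dist_norm add.assoc)
      qed
      have der: "(g has_real_derivative (pderiv_at k f (?p t) - pderiv_at k f x)) (at t)"
        if "\<bar>t\<bar> \<le> \<bar>h$k\<bar>" for t
      proof -
        have "?p t \<in> S" using near[OF that] d3 by (auto simp: dist_commute)
        then show ?thesis unfolding g_def
          by (auto intro!: derivative_eq_intros has_pderiv_at_along_axis ex)
      qed
      have "norm (g (h$k) - g 0) \<le> e / 2 * norm (h$k - 0)"
      proof (rule field_differentiable_bound[where S = "{- \<bar>h$k\<bar>..\<bar>h$k\<bar>}"
              and f' = "\<lambda>t. pderiv_at k f (?p t) - pderiv_at k f x"])
        fix t assume t: "t \<in> {- \<bar>h$k\<bar>..\<bar>h$k\<bar>}"
        then have t': "\<bar>t\<bar> \<le> \<bar>h$k\<bar>" by auto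
        show "(g has_real_derivative pderiv_at k f (?p t) - pderiv_at k f x)
            (at t within {- \<bar>h$k\<bar>..\<bar>h$k\<bar>})"
          using der[OF t'] by (rule DERIV_subset) simp
        show "norm (pderiv_at k f (?p t) - pderiv_at k f x) \<le> e / 2"
          using d2(2)[of "?p t"] near[OF t'] by simp
      qed auto
      also have "\<dots> \<le> e / 2 * norm h"
        using component_le_norm_cart[of h k] insert.prems by (simp add: mult_left_mono)
      finally have "\<bar>f (x + R (insert k I) h) - f (x + R I h) - h$k * pderiv_at k f x\<bar>
          \<le> e / 2 * norm h"
        unfolding g_def step by (simp add: algebra_simps)
      moreover have "\<bar>f (x + R I h) - f x - (\<Sum>i\<in>I. h$i * pderiv_at i f x)\<bar> \<le> e / 2 * norm h"
        using d1(2) h by simp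
      ultimately show ?thesis using insert.hyps by (simp add: abs_if split: if_splits)
    qed
    show ?case
      by (rule exI[of _ "min d1 (min d2 d3)"]) (use main d1 d2 d3 in \<open>simp add: R_def\<close>)
  qed
qed

lemma Ck_on_Suc_0_has_derivative:
  fixes f :: "real^'n::finite \<Rightarrow> real"
  assumes "open S" "Ck_on (Suc 0) S f" "x \<in> S"
  shows "(f has_derivative (\<lambda>h. grad f x \<bullet> h)) (at x)"
proof -
  have "\<exists>d>0. \<forall>y. norm (y - x) < d \<longrightarrow>
           norm (f y - f x - grad f x \<bullet> (y - x)) \<le> e * norm (y - x)" if "e > 0" for e
  proof -
    have "\<exists>d>0. \<forall>h. norm h < d \<longrightarrow>
        \<bar>f (x + (\<chi> i. if i \<in> UNIV then h$i else 0)) - f x - (\<Sum>i\<in>UNIV. h$i * pderiv_at i f x)\<bar>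
          \<le> e * norm h"
      by (rule C1_partial_increment[where S = S]) (use assms that in auto)
    then obtain d where d: "d > 0" "\<And>h. norm h < d \<Longrightarrow>
        \<bar>f (x + h) - f x - grad f x \<bullet> h\<bar> \<le> e * norm h"
      by (auto simp: grad_def inner_vec_def mult.commute)
    show ?thesis
      by (rule exI[of _ d]) (use d(1) d(2)[of "_ - x"] in auto)
  qed
  then show ?thesis
    unfolding has_derivative_within_alt by (auto intro: bounded_linear_inner_right)
qed

lemma
  fixes u :: "real^'n::finite \<Rightarrow> real"
  assumes "open S" "Ck_on 2 S u" "x + s *\<^sub>R h \<in> S"
  shows C2_DERIV_along_line:
      "((\<lambda>s. u (x + s *\<^sub>R h)) has_real_derivative grad u (x + s *\<^sub>R h) \<bullet> h) (at s)"
    and C2_DERIV_grad_along_line: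
      "((\<lambda>s. grad u (x + s *\<^sub>R h) \<bullet> h) has_real_derivative
          h \<bullet> (hessian u (x + s *\<^sub>R h) *v h)) (at s)"
proof -
  let ?y = "x + s *\<^sub>R h"
  have line: "((\<lambda>s. x + s *\<^sub>R h) has_derivative (\<lambda>r. r *\<^sub>R h)) (at s)"
    by (auto intro!: derivative_eq_intros)
  have C1: "Ck_on (Suc 0) S (pderiv_at j u)" "Ck_on (Suc 0) S u" for j
    using assms(2) by (auto simp: numeral_2_eq_2)
  have along: "((\<lambda>s. f (x + s *\<^sub>R h)) has_real_derivative grad f ?y \<bullet> h) (at s)"
    if "Ck_on (Suc 0) S f" for f
    using has_derivative_compose[OF line Ck_on_Suc_0_has_derivative[OF assms(1) that assms(3)]]
    unfolding has_field_derivative_def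
    by (rule has_derivative_eq_rhs) (simp add: fun_eq_iff mult.commute)
  show "((\<lambda>s. u (x + s *\<^sub>R h)) has_real_derivative grad u ?y \<bullet> h) (at s)"
    by (rule along[OF C1(2)])
  have "((\<lambda>s. \<Sum>j\<in>UNIV. pderiv_at j u (x + s *\<^sub>R h) * h$j) has_real_derivative
          (\<Sum>j\<in>UNIV. (grad (pderiv_at j u) ?y \<bullet> h) * h$j)) (at s)"
    by (intro DERIV_sum DERIV_cmult_right along C1)
  moreover have "(\<Sum>j\<in>UNIV. (grad (pderiv_at j u) ?y \<bullet> h) * h$j) = h \<bullet> (hessian u ?y *v h)"
    unfolding inner_vec_def grad_def hessian_def matrix_vector_mult_def
    by (simp add: sum_distrib_left sum_distrib_right) (subst sum.swap, simp add: mult_ac)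
  ultimately show "((\<lambda>s. grad u (x + s *\<^sub>R h) \<bullet> h) has_real_derivative
          h \<bullet> (hessian u ?y *v h)) (at s)"
    by (simp add: inner_vec_def grad_def)
qed

lemma local_max_derivative_tests:
  fixes f f' :: "real \<Rightarrow> real"
  assumes "d > 0" and der: "\<And>s. \<bar>s\<bar> < d \<Longrightarrow> (f has_real_derivative f' s) (at s)"
    and der2: "(f' has_real_derivative c) (at 0)"
    and max: "\<And>s. \<bar>s\<bar> < d \<Longrightarrow> f s \<le> f 0"
  shows "f' 0 = 0" "c \<le> 0"
proof -
  show z: "f' 0 = 0"
    by (rule DERIV_local_max[OF der \<open>d > 0\<close>]) (use assms in auto)
  show "c \<le> 0"
  proof (rule ccontr)
    assume "\<not> c \<le> 0"
    then obtain r where r: "r > 0" "\<And>h. 0 < h \<Longrightarrow> h < r \<Longrightarrow> 0 < f' h"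
      using DERIV_pos_inc_right[OF der2] z by auto
    define e where "e = min r d / 2"
    have e: "0 < e" "e < r" "e < d" using r \<open>d > 0\<close> by (auto simp: e_def)
    obtain \<xi> where "0 < \<xi>" "\<xi> < e" "f e - f 0 = (e - 0) * f' \<xi>"
      using MVT2[of 0 e f f'] e der by auto
    moreover from this have "f' \<xi> > 0" using r e by auto
    ultimately have "f e > f 0" using e by (simp add: algebra_simps)
    then show False using max[of e] e by simp
  qed
qed

section \<open>Trace pairing with a positive definite matrix\<close>

text \<open>
  With \<open>w\<close> the column \<open>k\<close> of \<open>A\<close>, the matrix \<open>A\<close> is the sum of \<open>w w\<^sup>T / A k k\<close> and of a matrix \<open>B\<close> whose
  row and column \<open>k\<close> vanish.  The first summand pairs with \<open>W\<close> to a value of the quadratic form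
  of \<open>W\<close>, and \<open>B\<close> inherits positive definiteness on the remaining indices.
\<close>

lemma trace_pairing_nonneg:
  fixes A W :: "'n \<Rightarrow> 'n \<Rightarrow> real"
  assumes "finite I"
    and "\<And>i j. i \<in> I \<Longrightarrow> j \<in> I \<Longrightarrow> A i j = A j i"
    and "\<And>v. \<exists>i\<in>I. v i \<noteq> 0 \<Longrightarrow> (\<Sum>i\<in>I. \<Sum>j\<in>I. v i * v j * A i j) > 0"
    and "\<And>v. (\<Sum>i\<in>I. \<Sum>j\<in>I. v i * v j * W i j) \<ge> 0"
  shows "(\<Sum>i\<in>I. \<Sum>j\<in>I. A i j * W i j) \<ge> 0"
  using assms
proof (induction I arbitrary: A rule: finite_induct)
  case empty
  then show ?case by simp
next
  case (insert k I)
  note sym = insert.prems(1) and pd = insert.prems(2) and W = insert.prems(3)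
  have split: "(\<Sum>i\<in>insert k I. \<Sum>j\<in>insert k I. F i j) =
      F k k + (\<Sum>j\<in>I. F k j) + (\<Sum>i\<in>I. F i k) + (\<Sum>i\<in>I. \<Sum>j\<in>I. F i j)" for F :: "'n \<Rightarrow> 'n \<Rightarrow> real"
    using insert.hyps by (simp add: sum.distrib)
  have kI: "i \<noteq> k" if "i \<in> I" for i using that insert.hyps by auto
  have pos: "A k k > 0"
    using pd[of "\<lambda>i. if i = k then 1 else 0"] kI unfolding split
    by (simp cong: sum.cong)
  \<comment> \<open>the Schur complement of the entry \<open>A k k\<close>\<close>
  define B where "B i j = A i j - A i k * A j k / A k k" for i j
  have "(\<Sum>i\<in>I. \<Sum>j\<in>I. B i j * W i j) \<ge> 0"
  proof (rule insert.IH)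
    show "B i j = B j i" if "i \<in> I" "j \<in> I" for i j
      using sym[of i j] that by (simp add: B_def mult.commute)
    show "(\<Sum>i\<in>I. \<Sum>j\<in>I. v i * v j * B i j) > 0" if v: "\<exists>i\<in>I. v i \<noteq> 0" for v
    proof -
      define c where "c = (\<Sum>j\<in>I. v j * A j k)"
      \<comment> \<open>the extension of \<open>v\<close> by the value at \<open>k\<close> that minimizes the form of \<open>A\<close>; the minimum is the
        form of \<open>B\<close> at \<open>v\<close>\<close>
      define w where "w i = (if i = k then - c / A k k else v i)" for i
      have w: "w i = v i" if "i \<in> I" for i using kI[OF that] by (simp add: w_def)
      have "0 < (\<Sum>i\<in>insert k I. \<Sum>j\<in>insert k I. w i * w j * A i j)"
        by (rule pd) (use v w in auto)
      also have "\<dots> = w k * w k * A k k + (\<Sum>j\<in>I. w k * v j * A j k) + (\<Sum>i\<in>I. v i * w k * A i k)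
          + (\<Sum>i\<in>I. \<Sum>j\<in>I. v i * v j * A i j)"
        unfolding split using sym by (simp add: w cong: sum.cong)
      also have "\<dots> = w k * w k * A k k + 2 * (w k * c) + (\<Sum>i\<in>I. \<Sum>j\<in>I. v i * v j * A i j)"
        by (simp add: c_def sum_distrib_left mult_ac)
      also have "\<dots> = (\<Sum>i\<in>I. \<Sum>j\<in>I. v i * v j * A i j) - c * c / A k k"
        using pos by (simp add: w_def field_simps)
      also have "c * c / A k k = (\<Sum>i\<in>I. \<Sum>j\<in>I. v i * v j * (A i k * A j k / A k k))"
        unfolding c_def sum_product by (simp add: sum_divide_distrib mult_ac)
      also have "(\<Sum>i\<in>I. \<Sum>j\<in>I. v i * v j * A i j) - \<dots> = (\<Sum>i\<in>I. \<Sum>j\<in>I. v i * v j * B i j)"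
        by (simp add: B_def sum_subtractf[symmetric] algebra_simps)
      finally show ?thesis .
    qed
    show "(\<Sum>i\<in>I. \<Sum>j\<in>I. v i * v j * W i j) \<ge> 0" for v
    proof -
      define w where "w i = (if i = k then 0 else v i)" for i
      have w: "w k = 0" "\<And>i. i \<in> I \<Longrightarrow> w i = v i" using kI by (auto simp: w_def)
      show ?thesis using W[of w] unfolding split by (simp add: w cong: sum.cong)
    qed
  qed
  also have "(\<Sum>i\<in>I. \<Sum>j\<in>I. B i j * W i j) = (\<Sum>i\<in>insert k I. \<Sum>j\<in>insert k I. B i j * W i j)"
    unfolding split using pos sym by (simp add: B_def cong: sum.cong)
  also have "\<dots> = (\<Sum>i\<in>insert k I. \<Sum>j\<in>insert k I. A i j * W i j)
      - (\<Sum>i\<in>insert k I. \<Sum>j\<in>insert k I. A i k * A j k * W i j) / A k k"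
    unfolding B_def by (simp add: left_diff_distrib sum_subtractf sum_divide_distrib)
  also have "\<dots> \<le> (\<Sum>i\<in>insert k I. \<Sum>j\<in>insert k I. A i j * W i j)"
    using W[of "\<lambda>i. A i k"] pos by simp
  finally show ?case .
qed

section \<open>Approximately convex functions\<close>

text \<open>
  Adjoining one more point to a convex combination uses approximate convexity once, so the error grows
  by at most \<open>\<epsilon>\<close> per point.
\<close>

lemma approx_convex_finite_hull:
  fixes u :: "'a::real_vector \<Rightarrow> real"
  assumes "convex \<Omega>" "0 \<le> \<epsilon>"
    and approx: "\<And>x y t. x \<in> \<Omega> \<Longrightarrow> y \<in> \<Omega> \<Longrightarrow> t \<in> {0..1} \<Longrightarrow> convexity_fun u x y t \<le> \<epsilon>"
    and "finite S" "S \<subseteq> epigraph \<Omega> u" "p \<in> convex hull S"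
  shows "fst p \<in> \<Omega> \<and> u (fst p) \<le> snd p + real (card S) * \<epsilon>"
  using \<open>finite S\<close> \<open>S \<subseteq> epigraph \<Omega> u\<close> \<open>p \<in> convex hull S\<close>
proof (induction S arbitrary: p rule: finite_induct)
  case empty
  then show ?case by simp
next
  case (insert a S)
  have a: "fst a \<in> \<Omega>" "u (fst a) \<le> snd a"
    using insert.prems by (auto simp: epigraph_def)
  show ?case
  proof (cases "S = {}")
    case True
    then show ?thesis using a insert.prems \<open>0 \<le> \<epsilon>\<close> by auto
  next
    case False
    obtain \<mu> \<nu> q where p: "\<mu> \<ge> 0" "\<nu> \<ge> 0" "\<mu> + \<nu> = 1" "q \<in> convex hull S"
        "p = \<mu> *\<^sub>R a + \<nu> *\<^sub>R q"
      using insert.prems(2) unfolding convex_hull_insert[OF False] mem_Collect_eq by blast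
    have q: "fst q \<in> \<Omega>" "u (fst q) \<le> snd q + real (card S) * \<epsilon>"
      using insert.IH[OF _ p(4)] insert.prems by auto
    have "\<nu> = 1 - \<mu>" using p by simp
    have "u (fst p) \<le> \<mu> * u (fst a) + \<nu> * u (fst q) + \<epsilon>"
      using approx[OF a(1) q(1), of \<mu>] p by (simp add: convexity_fun_def \<open>\<nu> = 1 - \<mu>\<close>)
    also have "\<dots> \<le> \<mu> * snd a + \<nu> * (snd q + real (card S) * \<epsilon>) + \<epsilon>"
      using a q p by (intro add_mono mult_left_mono) auto
    also have "\<dots> \<le> snd p + real (card (insert a S)) * \<epsilon>"
    proof -
      have "\<nu> * (real (card S) * \<epsilon>) \<le> 1 * (real (card S) * \<epsilon>)"
        using p \<open>0 \<le> \<epsilon>\<close> by (intro mult_right_mono) auto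
      then show ?thesis using p insert.hyps by (simp add: algebra_simps)
    qed
    finally show ?thesis
      using convexD[OF \<open>convex \<Omega>\<close> a(1) q(1)] p by auto
  qed
qed

text \<open>
  The lower boundary of the convex hull of the epigraph of \<open>u\<close> is the largest convex minorant of \<open>u\<close>.
  Caratheodory's theorem bounds how far below \<open>u\<close> it can lie: the epigraph has one dimension more
  than the domain, whence \<open>DIM('a) + 2\<close> points.
\<close>

theorem Hyers_Ulam_approx_convex:
  fixes u :: "'a::euclidean_space \<Rightarrow> real"
  assumes "convex \<Omega>" "0 \<le> \<epsilon>"
    and approx: "\<And>x y t. x \<in> \<Omega> \<Longrightarrow> y \<in> \<Omega> \<Longrightarrow> t \<in> {0..1} \<Longrightarrow> convexity_fun u x y t \<le> \<epsilon>"
  obtains v where "convex_on \<Omega> v"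
    "\<And>x. x \<in> \<Omega> \<Longrightarrow> v x \<le> u x" "\<And>x. x \<in> \<Omega> \<Longrightarrow> u x \<le> v x + real (DIM('a) + 2) * \<epsilon>"
proof
  define K where "K = real (DIM('a) + 2) * \<epsilon>"
  define H where "H = convex hull (epigraph \<Omega> u)"
  define v where "v x = Inf {y. (x, y) \<in> H}" for x
  have lower: "u x - K \<le> y" if "(x, y) \<in> H" for x y
  proof -
    have "\<exists>S. finite S \<and> S \<subseteq> epigraph \<Omega> u \<and> card S \<le> DIM('a \<times> real) + 1 \<and>
        (x, y) \<in> convex hull S"
      using that[unfolded H_def] by (subst (asm) caratheodory) (erule CollectD)
    then obtain S where S: "finite S" "S \<subseteq> epigraph \<Omega> u" "card S \<le> DIM('a \<times> real) + 1"
        "(x, y) \<in> convex hull S"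
      by blast
    have "u x \<le> y + real (card S) * \<epsilon>"
      using approx_convex_finite_hull[OF assms S(1,2,4)] by auto
    also have "\<dots> \<le> y + K"
      unfolding K_def using S(3) \<open>0 \<le> \<epsilon>\<close> by (intro add_left_mono mult_right_mono) auto
    finally show ?thesis by simp
  qed
  have bdd: "bdd_below {y. (x, y) \<in> H}" for x
    using lower by (intro bdd_belowI[of _ "u x - K"]) auto
  have graph: "(x, u x) \<in> H" if "x \<in> \<Omega>" for x
    unfolding H_def using that by (intro hull_inc) (simp add: mem_epigraph)
  show "v x \<le> u x" if "x \<in> \<Omega>" for x
    unfolding v_def using graph[OF that] by (intro cInf_lower bdd) auto
  show "u x \<le> v x + real (DIM('a) + 2) * \<epsilon>" if "x \<in> \<Omega>" for x
  proof -
    have "u x - K \<le> v x"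
      unfolding v_def using graph[OF that] lower by (intro cInf_greatest) auto
    then show ?thesis by (simp add: K_def)
  qed
  show "convex_on \<Omega> v"
    unfolding convex_on_def
  proof (intro conjI ballI allI impI \<open>convex \<Omega>\<close>)
    fix x y and \<mu> \<nu> :: real
    assume xy: "x \<in> \<Omega>" "y \<in> \<Omega>" and w: "0 \<le> \<mu>" "0 \<le> \<nu>" "\<mu> + \<nu> = 1"
    show "v (\<mu> *\<^sub>R x + \<nu> *\<^sub>R y) \<le> \<mu> * v x + \<nu> * v y"
    proof (rule field_le_epsilon)
      fix e :: real assume "e > 0"
      obtain r where r: "(x, r) \<in> H" "r < v x + e"
        using cInf_lessD[of "{r. (x, r) \<in> H}" "v x + e"] graph[OF xy(1)] \<open>e > 0\<close>
        unfolding v_def by auto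
      obtain s where s: "(y, s) \<in> H" "s < v y + e"
        using cInf_lessD[of "{r. (y, r) \<in> H}" "v y + e"] graph[OF xy(2)] \<open>e > 0\<close>
        unfolding v_def by auto
      have "(\<mu> *\<^sub>R x + \<nu> *\<^sub>R y, \<mu> * r + \<nu> * s) \<in> H"
        using convexD[of H, OF _ r(1) s(1) w] by (simp add: H_def)
      then have "v (\<mu> *\<^sub>R x + \<nu> *\<^sub>R y) \<le> \<mu> * r + \<nu> * s"
        unfolding v_def[of "\<mu> *\<^sub>R x + \<nu> *\<^sub>R y"] by (intro cInf_lower bdd) auto
      also have "\<dots> \<le> \<mu> * (v x + e) + \<nu> * (v y + e)"
        using r s w by (intro add_mono mult_left_mono) auto
      also have "\<dots> = \<mu> * v x + \<nu> * v y + (\<mu> + \<nu>) * e" by (simp add: algebra_simps)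
      finally show "v (\<mu> *\<^sub>R x + \<nu> *\<^sub>R y) \<le> \<mu> * v x + \<nu> * v y + e" using w by simp
    qed
  qed
qed

section \<open>The essential supremum of a continuous function\<close>

lemma Linf_norm_le:
  fixes f :: "'a::euclidean_space \<Rightarrow> real"
  assumes "open \<Omega>" "continuous_on \<Omega> f" "\<And>x. x \<in> \<Omega> \<Longrightarrow> \<bar>f x\<bar> \<le> c"
  shows "Linf_norm \<Omega> f \<le> ereal c"
  unfolding Linf_norm_def
proof (rule esssup_I)
  have "f \<in> borel_measurable (lebesgue_on \<Omega>)"
    using assms by (intro continuous_imp_measurable_on_sets_lebesgue) auto
  then show "(\<lambda>x. ereal \<bar>f x\<bar>) \<in> borel_measurable (lebesgue_on \<Omega>)" by measurable
  show "AE x in lebesgue_on \<Omega>. ereal \<bar>f x\<bar> \<le> ereal c"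
    using assms by (intro AE_I2) auto
qed

text \<open>
  If \<open>f\<close> is continuous, a value above the essential supremum forces \<open>f\<close> to exceed the essential
  supremum on a nonempty open set, which has positive measure.
\<close>

lemma abs_le_Linf_norm:
  fixes f :: "'a::euclidean_space \<Rightarrow> real"
  assumes "open \<Omega>" "continuous_on \<Omega> f" "x \<in> \<Omega>"
  shows "ereal \<bar>f x\<bar> \<le> Linf_norm \<Omega> f"
proof (rule ccontr)
  let ?m = "Linf_norm \<Omega> f"
  assume "\<not> ereal \<bar>f x\<bar> \<le> ?m"
  then obtain c where c: "?m < ereal c" "c < \<bar>f x\<bar>"
    using ereal_dense2[of ?m "ereal \<bar>f x\<bar>"] by (auto simp: not_le)
  let ?V = "{y \<in> \<Omega>. \<bar>f y\<bar> > c}"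
  have "open ?V"
  proof -
    have "continuous_on \<Omega> (\<lambda>y. \<bar>f y\<bar>)" using assms by (intro continuous_intros)
    from continuous_open_preimage[OF this \<open>open \<Omega>\<close>, of "{c<..}"]
    show ?thesis by (simp add: vimage_def Int_def)
  qed
  have "AE y in lebesgue_on \<Omega>. ereal \<bar>f y\<bar> \<le> ?m"
    unfolding Linf_norm_def by (rule esssup_AE)
  then have "AE y in lebesgue. y \<in> \<Omega> \<longrightarrow> ereal \<bar>f y\<bar> \<le> ?m"
    using \<open>open \<Omega>\<close> by (subst (asm) AE_restrict_space_iff) auto
  then have "AE y in lebesgue. y \<notin> ?V"
    by (rule AE_mp) (use c in \<open>auto intro!: AE_I2 dest: order.strict_trans1\<close>)
  then have "negligible ?V"
    using \<open>open ?V\<close> by (simp add: negligible_iff_null_sets AE_iff_null_sets)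
  then have "?V = {}" using open_not_negligible[OF \<open>open ?V\<close>] by blast
  then show False using c assms by auto
qed

section \<open>Interior maxima of the convexity function\<close>

text \<open>
  These are the first- and second-order conditions at \<open>s = 0\<close> when \<open>x1\<close> and \<open>x3\<close> move along the lines
  \<open>x1 + s \<alpha> h\<close> and \<open>x3 + s \<gamma> h\<close>; the intermediate point then moves with velocity
  \<open>(t \<alpha> + (1 - t) \<gamma>) h\<close>.  Moving the two points at different speeds in a common direction is what
  later produces a harmonic instead of an arithmetic mean.
\<close>

lemma convexity_fun_interior_max:
  fixes u :: "real^'n::finite \<Rightarrow> real"
  assumes \<Omega>: "open \<Omega>" "convex \<Omega>" and u: "Ck_on 2 \<Omega> u"
    and x: "x1 \<in> \<Omega>" "x3 \<in> \<Omega>" and t: "0 < t" "t < 1"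
    and max: "\<And>y1 y3. y1 \<in> \<Omega> \<Longrightarrow> y3 \<in> \<Omega> \<Longrightarrow> convexity_fun u y1 y3 t \<le> convexity_fun u x1 x3 t"
  defines "x2 \<equiv> t *\<^sub>R x1 + (1 - t) *\<^sub>R x3"
  shows "grad u x1 = grad u x2" "grad u x3 = grad u x2"
    and "(t * \<alpha> + (1 - t) * \<gamma>)\<^sup>2 * (h \<bullet> (hessian u x2 *v h))
      \<le> t * \<alpha>\<^sup>2 * (h \<bullet> (hessian u x1 *v h)) + (1 - t) * \<gamma>\<^sup>2 * (h \<bullet> (hessian u x3 *v h))"
proof -
  have x2: "x2 \<in> \<Omega>"
    unfolding x2_def using \<Omega>(2) x t by (intro convexD) auto
  have *: "(t * \<alpha> + (1 - t) * \<gamma>) * (grad u x2 \<bullet> h)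
        = t * \<alpha> * (grad u x1 \<bullet> h) + (1 - t) * \<gamma> * (grad u x3 \<bullet> h)
      \<and> (t * \<alpha> + (1 - t) * \<gamma>)\<^sup>2 * (h \<bullet> (hessian u x2 *v h))
        \<le> t * \<alpha>\<^sup>2 * (h \<bullet> (hessian u x1 *v h)) + (1 - t) * \<gamma>\<^sup>2 * (h \<bullet> (hessian u x3 *v h))"
    for \<alpha> \<gamma> h
  proof -
    define c where "c = t * \<alpha> + (1 - t) * \<gamma>"
    let ?p1 = "\<lambda>s. x1 + s *\<^sub>R (\<alpha> *\<^sub>R h)" and ?p2 = "\<lambda>s. x2 + s *\<^sub>R (c *\<^sub>R h)"
      and ?p3 = "\<lambda>s. x3 + s *\<^sub>R (\<gamma> *\<^sub>R h)"
    define f where "f s = u (?p2 s) - t * u (?p1 s) - (1 - t) * u (?p3 s)" for s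
    define f' where "f' s = grad u (?p2 s) \<bullet> (c *\<^sub>R h) - t * (grad u (?p1 s) \<bullet> (\<alpha> *\<^sub>R h))
        - (1 - t) * (grad u (?p3 s) \<bullet> (\<gamma> *\<^sub>R h))" for s
    have near: "\<forall>\<^sub>F s in nhds 0. x + s *\<^sub>R k \<in> \<Omega>" if "x \<in> \<Omega>" for x k :: "real^'n"
    proof (rule topological_tendstoD)
      have "((\<lambda>s. x + s *\<^sub>R k) \<longlongrightarrow> x + 0 *\<^sub>R k) (nhds 0)"
        by (intro tendsto_intros filterlim_ident)
      then show "((\<lambda>s. x + s *\<^sub>R k) \<longlongrightarrow> x) (nhds 0)" by simp
    qed (use \<Omega> that in auto)
    have "\<forall>\<^sub>F s in nhds 0. ?p1 s \<in> \<Omega> \<and> ?p2 s \<in> \<Omega> \<and> ?p3 s \<in> \<Omega>"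
      by (intro eventually_conj near x x2)
    then obtain d where d: "d > 0"
      "\<And>s. \<bar>s\<bar> < d \<Longrightarrow> ?p1 s \<in> \<Omega>" "\<And>s. \<bar>s\<bar> < d \<Longrightarrow> ?p2 s \<in> \<Omega>" "\<And>s. \<bar>s\<bar> < d \<Longrightarrow> ?p3 s \<in> \<Omega>"
      unfolding eventually_nhds_metric by auto
    have mid: "t *\<^sub>R ?p1 s + (1 - t) *\<^sub>R ?p3 s = ?p2 s" for s
      by (simp add: x2_def c_def algebra_simps)
    have fC: "f s = convexity_fun u (?p1 s) (?p3 s) t" for s
      unfolding convexity_fun_def mid f_def by simp
    have d1: "(f has_real_derivative f' s) (at s)" if "\<bar>s\<bar> < d" for s
      unfolding f_def[abs_def] f'_def using d that
      by (intro DERIV_diff DERIV_cmult C2_DERIV_along_line[OF \<Omega>(1) u]) auto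
    have d2: "(f' has_real_derivative (c *\<^sub>R h) \<bullet> (hessian u (?p2 0) *v (c *\<^sub>R h))
        - t * ((\<alpha> *\<^sub>R h) \<bullet> (hessian u (?p1 0) *v (\<alpha> *\<^sub>R h)))
        - (1 - t) * ((\<gamma> *\<^sub>R h) \<bullet> (hessian u (?p3 0) *v (\<gamma> *\<^sub>R h)))) (at 0)"
      unfolding f'_def[abs_def] using x x2
      by (intro DERIV_diff DERIV_cmult C2_DERIV_grad_along_line[OF \<Omega>(1) u]) auto
    have fmax: "f s \<le> f 0" if "\<bar>s\<bar> < d" for s
      unfolding fC using max d that by simp
    show ?thesis
      using local_max_derivative_tests[OF d(1) d1 d2 fmax]
      by (simp add: f'_def c_def matrix_vector_mult_scaleR power2_eq_square algebra_simps)
  qed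
  \<comment> \<open>moving only one of the two end points\<close>
  show "grad u x1 = grad u x2"
    using *[of 1 0] t by (intro vector_eq_rdot[THEN iffD1]) auto
  show "grad u x3 = grad u x2"
    using *[of 0 1] t by (intro vector_eq_rdot[THEN iffD1]) auto
  show "(t * \<alpha> + (1 - t) * \<gamma>)\<^sup>2 * (h \<bullet> (hessian u x2 *v h))
      \<le> t * \<alpha>\<^sup>2 * (h \<bullet> (hessian u x1 *v h)) + (1 - t) * \<gamma>\<^sup>2 * (h \<bullet> (hessian u x3 *v h))"
    using * by blast
qed

lemma trace_pairing_mono:
  fixes A H1 H2 H3 :: "real^'n^'n::finite"
  assumes "symmetric_matrix A" "positive_definite A"
    and le: "\<And>h. c2 * (h \<bullet> (H2 *v h)) \<le> c1 * (h \<bullet> (H1 *v h)) + c3 * (h \<bullet> (H3 *v h))"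
  shows "c2 * (\<Sum>i\<in>UNIV. \<Sum>j\<in>UNIV. A$i$j * H2$i$j)
    \<le> c1 * (\<Sum>i\<in>UNIV. \<Sum>j\<in>UNIV. A$i$j * H1$i$j) + c3 * (\<Sum>i\<in>UNIV. \<Sum>j\<in>UNIV. A$i$j * H3$i$j)"
proof -
  have form: "(\<chi> i. v i) \<bullet> (B *v (\<chi> i. v i)) = (\<Sum>i\<in>UNIV. \<Sum>j\<in>UNIV. v i * v j * B$i$j)"
    for v :: "'n \<Rightarrow> real" and B :: "real^'n^'n"
    by (simp add: inner_vec_def matrix_vector_mult_def sum_distrib_left mult_ac)
  let ?W = "\<lambda>i j. c1 * H1$i$j + c3 * H3$i$j - c2 * H2$i$j"
  have "0 \<le> (\<Sum>i\<in>UNIV. \<Sum>j\<in>UNIV. A$i$j * ?W i j)"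
  proof (rule trace_pairing_nonneg)
    show "A$i$j = A$j$i" for i j
      using assms(1) unfolding symmetric_matrix_def by (metis transpose_def vec_lambda_beta)
    show "(\<Sum>i\<in>UNIV. \<Sum>j\<in>UNIV. v i * v j * A$i$j) > 0" if "\<exists>i\<in>UNIV. v i \<noteq> 0" for v
      using assms(2) that unfolding positive_definite_def form[symmetric]
      by (simp add: vec_eq_iff)
    show "(\<Sum>i\<in>UNIV. \<Sum>j\<in>UNIV. v i * v j * ?W i j) \<ge> 0" for v
      using le[of "\<chi> i. v i"] unfolding form
      by (simp add: algebra_simps sum.distrib sum_subtractf sum_distrib_left)
  qed simp
  then show ?thesis
    by (simp add: algebra_simps sum.distrib sum_subtractf sum_distrib_left)
qed

text \<open>
  The choice \<open>\<alpha> = b3\<close>, \<open>\<gamma> = b1\<close> minimizes the ratio of the two sides and gives the harmonic mean if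
  \<open>D > 0\<close>.  The choice \<open>\<alpha> = 1 - t\<close>, \<open>\<gamma> = - t\<close>, which keeps the intermediate point fixed, shows
  \<open>D \<ge> 0\<close>.  If \<open>D = 0\<close>, the difference of the two sides is a nonnegative quadratic form that vanishes
  at \<open>(1 - t, - t)\<close>, hence so does its gradient there, and this forces \<open>b1 = b3 = 0\<close>.
\<close>

lemma harmonic_bound_of_quadratic:
  fixes t b1 b2 b3 :: real
  assumes t: "0 < t" "t < 1"
    and quad: "\<And>\<alpha> \<gamma>. (t * \<alpha> + (1 - t) * \<gamma>)\<^sup>2 * b2 \<le> t * \<alpha>\<^sup>2 * b1 + (1 - t) * \<gamma>\<^sup>2 * b3"
  defines "D \<equiv> (1 - t) * b1 + t * b3"
  shows "D > 0 \<and> b2 \<le> b1 * b3 / D \<or> b1 = 0 \<and> b3 = 0 \<and> b2 \<le> 0"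
proof (cases "D > 0")
  case True
  have "D\<^sup>2 * b2 \<le> b1 * b3 * D"
    using quad[of b3 b1] by (simp add: D_def power2_eq_square algebra_simps)
  then have "D * (D * b2) \<le> D * (b1 * b3)"
    by (simp add: power2_eq_square algebra_simps)
  then have "D * b2 \<le> b1 * b3" using True by simp
  then show ?thesis using True by (simp add: field_simps)
next
  case False
  have "0 \<le> t * (1 - t) * D"
    using quad[of "1 - t" "- t"] by (simp add: D_def power2_eq_square algebra_simps)
  moreover have "t * (1 - t) > 0" using t by simp
  ultimately have D: "D = 0" using False by (simp add: zero_le_mult_iff)
  define p where "p = t * b2 - b1"
  define q where "q = (1 - t) * b1"
  \<comment> \<open>perturbing the zero \<open>(1 - t, - t)\<close> of the form in its first argument\<close>
  have s: "s\<^sup>2 * p \<le> 2 * q * s" for s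
  proof -
    have "t * (s\<^sup>2 * p) \<le> t * (2 * q * s) + t * (1 - t) * D"
      using quad[of "1 - t + s" "- t"]
      by (simp add: D_def p_def q_def power2_eq_square algebra_simps)
    then show ?thesis using D t by simp
  qed
  have "q = 0"
  proof (rule ccontr)
    assume "q \<noteq> 0"
    \<comment> \<open>a step \<open>s = - q / r\<close> short enough for the linear term to dominate the quadratic one\<close>
    define r where "r = \<bar>p\<bar> + 1"
    have r: "r > 0" "p + 2 * r > 0" by (auto simp: r_def)
    have "q\<^sup>2 * (p + 2 * r) \<le> 0"
      using s[of "- q / r"] r(1) by (simp add: field_simps power2_eq_square)
    then show False using r(2) \<open>q \<noteq> 0\<close> by (simp add: mult_le_0_iff)
  qed
  then have "b1 = 0" using t by (simp add: q_def)
  moreover from this have "b3 = 0" using D t by (simp add: D_def)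
  moreover have "b2 \<le> 0" using quad[of 1 1] calculation by simp
  ultimately show ?thesis by simp
qed

section \<open>Quantitative convexity of solutions\<close>

lemma norm_grad_le_C2_norm:
  assumes "x \<in> \<Omega>"
  shows "ereal (norm (grad f x)) \<le> C2_norm \<Omega> f"
proof -
  have "0 \<le> (SUP x\<in>\<Omega>. ereal \<bar>f x\<bar>)"
    using assms by (intro SUP_upper2) auto
  moreover have "ereal (norm (grad f x)) \<le> (SUP x\<in>\<Omega>. ereal (norm (grad f x)))"
    using assms by (intro SUP_upper)
  moreover have "0 \<le> (SUP x\<in>\<Omega>. ereal (onorm ((*v) (hessian f x))))"
    using assms by (intro SUP_upper2) (auto intro!: onorm_pos_le)
  ultimately have "0 + ereal (norm (grad f x)) + 0 \<le> C2_norm \<Omega> f"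
    unfolding C2_norm_def by (intro add_mono)
  then show ?thesis by simp
qed

lemma mean_value_lower_bound:
  fixes g :: "real \<Rightarrow> real"
  assumes "s < r" and "\<And>y. g differentiable (at y)"
    and "\<And>y. s \<le> y \<Longrightarrow> y \<le> r \<Longrightarrow> \<beta> \<le> deriv g y"
  shows "\<beta> * (r - s) \<le> g r - g s"
proof -
  obtain y where "s < y" "y < r" "g r - g s = (r - s) * deriv g y"
    using MVT2[OF \<open>s < r\<close>, of g "deriv g"] assms(2) DERIV_deriv_iff_real_differentiable by blast
  then show ?thesis using assms(3)[of y] \<open>s < r\<close> by (simp add: mult.commute)
qed

text \<open>
  At the maximum, \<open>b(x2, u(x2), z)\<close> is at most the term that the harmonic convexity function subtracts
  from \<open>b(x2, s2, z)\<close>.  So \<open>b(x2, _, z)\<close> rises by at most \<open>\<delta>\<close> between \<open>s2\<close> and \<open>u(x2)\<close>, with slope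
  at least \<open>\<beta>\<close> throughout, and \<open>u(x2) - s2\<close> is the maximum itself.
\<close>

lemma max_convexity_fun_le:
  fixes u :: "real^'n::finite \<Rightarrow> real" and b :: "real^'n \<Rightarrow> real \<Rightarrow> real^'n \<Rightarrow> real"
  assumes \<Omega>: "open \<Omega>" "convex \<Omega>" and u: "Ck_on 2 \<Omega> u"
    and b_diff: "\<And>x s z. x \<in> \<Omega> \<Longrightarrow> (\<lambda>r. b x r z) differentiable (at s)"
    and A: "\<And>\<xi>. symmetric_matrix (\<chi> i j. a i j \<xi>)" "\<And>\<xi>. positive_definite (\<chi> i j. a i j \<xi>)"
    and eq: "\<And>x. x \<in> \<Omega> \<Longrightarrow>
      (\<Sum>i\<in>UNIV. \<Sum>j\<in>UNIV. a i j (grad u x) * hessian u x $ i $ j) = b x (u x) (grad u x)"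
    and "\<beta> > 0"
    and b_mono: "\<And>x s z. x \<in> \<Omega> \<Longrightarrow> ereal \<bar>s\<bar> \<le> Linf_norm \<Omega> u \<Longrightarrow> ereal (norm z) \<le> C2_norm \<Omega> u \<Longrightarrow>
      deriv (\<lambda>r. b x r z) s \<ge> \<beta>"
    and HC: "\<And>z x1 x3 t. ereal (norm z) \<le> C2_norm \<Omega> u \<Longrightarrow> x1 \<in> \<Omega> \<Longrightarrow> x3 \<in> \<Omega> \<Longrightarrow> t \<in> {0..1} \<Longrightarrow>
      harmonic_convexity_defined b u z x1 x3 t \<Longrightarrow> harmonic_convexity_fun b u z x1 x3 t \<ge> - \<delta>"
    and x: "x1 \<in> \<Omega>" "x3 \<in> \<Omega>" and t01: "t \<in> {0..1}"
    and pos: "convexity_fun u x1 x3 t > 0"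
    and max: "\<And>y1 y3. y1 \<in> \<Omega> \<Longrightarrow> y3 \<in> \<Omega> \<Longrightarrow> convexity_fun u y1 y3 t \<le> convexity_fun u x1 x3 t"
  shows "convexity_fun u x1 x3 t \<le> \<delta> / \<beta>"
proof -
  have t: "0 < t" "t < 1"
  proof -
    have "t \<noteq> 0" "t \<noteq> 1" using pos by (auto simp: convexity_fun_def)
    then show "0 < t" "t < 1" using t01 by auto
  qed
  define x2 where "x2 = t *\<^sub>R x1 + (1 - t) *\<^sub>R x3"
  define s2 where "s2 = t * u x1 + (1 - t) * u x3"
  define z where "z = grad u x2"
  have x2: "x2 \<in> \<Omega>"
    unfolding x2_def using \<Omega>(2) x t by (intro convexD) auto
  note crit = convexity_fun_interior_max[OF \<Omega> u x t max, folded x2_def]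
  have z: "ereal (norm z) \<le> C2_norm \<Omega> u"
    unfolding z_def by (rule norm_grad_le_C2_norm[OF x2])
  let ?b1 = "b x1 (u x1) z" and ?b2 = "b x2 (u x2) z" and ?b3 = "b x3 (u x3) z"
  have b: "(\<Sum>i\<in>UNIV. \<Sum>j\<in>UNIV. (\<chi> i j. a i j z)$i$j * hessian u y $ i $ j) = b y (u y) z"
    if "y \<in> {x1, x2, x3}" for y
    using that eq[OF x(1)] eq[OF x(2)] eq[OF x2] crit(1,2) by (auto simp: z_def)
  have "(t * \<alpha> + (1 - t) * \<gamma>)\<^sup>2 * ?b2 \<le> t * \<alpha>\<^sup>2 * ?b1 + (1 - t) * \<gamma>\<^sup>2 * ?b3" for \<alpha> \<gamma>
    using trace_pairing_mono[OF A[of z] crit(3)] by (simp only: b insertI1 insertI2)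
  from harmonic_bound_of_quadratic[OF t this]
  have *: "harmonic_convexity_defined b u z x1 x3 t"
    "?b2 - b x2 s2 z \<le> - harmonic_convexity_fun b u z x1 x3 t"
    by (auto simp: harmonic_convexity_defined_def harmonic_convexity_fun_def Let_def
        x2_def[symmetric] s2_def[symmetric])
  have C: "convexity_fun u x1 x3 t = u x2 - s2"
    by (simp add: convexity_fun_def x2_def s2_def)
  have "\<beta> * (u x2 - s2) \<le> ?b2 - b x2 s2 z"
  proof (rule mean_value_lower_bound)
    show "s2 < u x2" using pos C by simp
    fix s assume s: "s2 \<le> s" "s \<le> u x2"
    \<comment> \<open>Every \<open>s\<close> between \<open>s2\<close> and \<open>u(x2)\<close> is bounded by the largest of the three values of \<open>\<bar>u\<bar>\<close>;
      passing through this real \<open>K\<close> covers an infinite norm as well.\<close>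
    have cont: "continuous_on \<Omega> u" using u by (simp add: numeral_2_eq_2)
    define K where "K = Max {\<bar>u x1\<bar>, \<bar>u x2\<bar>, \<bar>u x3\<bar>}"
    have K: "\<bar>u x1\<bar> \<le> K" "\<bar>u x2\<bar> \<le> K" "\<bar>u x3\<bar> \<le> K" by (auto simp: K_def)
    have "K \<in> {\<bar>u x1\<bar>, \<bar>u x2\<bar>, \<bar>u x3\<bar>}" unfolding K_def by (rule Max_in) auto
    then have Km: "ereal K \<le> Linf_norm \<Omega> u"
      using abs_le_Linf_norm[OF \<Omega>(1) cont] x x2 by auto
    have "- K = t * (- K) + (1 - t) * (- K)" by (simp add: algebra_simps)
    also have "\<dots> \<le> s2"
      unfolding s2_def using K t by (intro add_mono mult_left_mono) auto
    finally have "\<bar>s\<bar> \<le> K" using s K by auto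
    then have "ereal \<bar>s\<bar> \<le> Linf_norm \<Omega> u"
      using Km by (meson ereal_less_eq(3) order_trans)
    then show "\<beta> \<le> deriv (\<lambda>r. b x2 r z) s" by (rule b_mono[OF x2 _ z])
  qed (rule b_diff[OF x2])
  also have "\<dots> \<le> \<delta>"
    using *(2) HC[OF z x t01 *(1)] by simp
  finally show ?thesis
    using \<open>\<beta> > 0\<close> C by (simp add: pos_le_divide_eq mult.commute)
qed

theorem theorem2p10:
  shows "\<exists>k>0::real.
    \<forall>(\<Omega> :: (real^'n::finite) set) (a :: 'n \<Rightarrow> 'n \<Rightarrow> real^'n \<Rightarrow> real)
      (b :: real^'n \<Rightarrow> real \<Rightarrow> real^'n \<Rightarrow> real) (u :: real^'n \<Rightarrow> real)
      (M :: ereal) (m :: ereal) (\<delta> :: real) (\<beta> :: real).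
      is_domain \<Omega> \<longrightarrow> convex \<Omega> \<longrightarrow>
      (\<forall>i j. a i j \<in> borel_measurable lebesgue) \<longrightarrow>
      (\<forall>x\<in>\<Omega>. \<forall>s z. (\<lambda>r. b x r z) differentiable (at s)) \<longrightarrow>
      (\<forall>\<xi>. symmetric_matrix (\<chi> i j. a i j \<xi>) \<and> positive_definite (\<chi> i j. a i j \<xi>)) \<longrightarrow>
      Ck_on 2 \<Omega> u \<longrightarrow> continuous_on (closure \<Omega>) u \<longrightarrow>
      (\<forall>x\<in>\<Omega>. (\<Sum>i\<in>UNIV. \<Sum>j\<in>UNIV. a i j (grad u x) * hessian u x $ i $ j)
                - b x (u x) (grad u x) = 0) \<longrightarrow>
      M = C2_norm \<Omega> u \<longrightarrow> m = Linf_norm \<Omega> u \<longrightarrow>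
      \<delta> \<ge> 0 \<longrightarrow> \<beta> > 0 \<longrightarrow>
      (\<forall>x\<in>\<Omega>. \<forall>s z. ereal \<bar>s\<bar> \<le> m \<longrightarrow> ereal (norm z) \<le> M \<longrightarrow>
         deriv (\<lambda>r. b x r z) s \<ge> \<beta>) \<longrightarrow>
      (\<forall>z. ereal (norm z) \<le> M \<longrightarrow>
         (\<forall>x1\<in>\<Omega>. \<forall>x3\<in>\<Omega>. \<forall>t\<in>{0..1}.
            harmonic_convexity_defined b u z x1 x3 t \<longrightarrow>
            harmonic_convexity_fun b u z x1 x3 t \<ge> - \<delta>)) \<longrightarrow>
      achieves_pos_interior_max \<Omega> u \<longrightarrow>
      (\<exists>v. convex_on \<Omega> v \<and> Linf_norm \<Omega> (\<lambda>x. u x - v x) \<le> ereal (k / \<beta> * \<delta>))"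
proof (intro exI[of _ "real (DIM(real^'n) + 2)"] conjI allI impI)
  fix \<Omega> :: "(real^'n) set" and a b u and M m :: ereal and \<delta> \<beta> :: real
  assume dom: "is_domain \<Omega>" and "convex \<Omega>"
    and "\<forall>i j. a i j \<in> borel_measurable lebesgue"
    and b: "\<forall>x\<in>\<Omega>. \<forall>s z. (\<lambda>r. b x r z) differentiable (at s)"
    and A: "\<forall>\<xi>. symmetric_matrix (\<chi> i j. a i j \<xi>) \<and> positive_definite (\<chi> i j. a i j \<xi>)"
    and u: "Ck_on 2 \<Omega> u" "continuous_on (closure \<Omega>) u"
    and eq: "\<forall>x\<in>\<Omega>. (\<Sum>i\<in>UNIV. \<Sum>j\<in>UNIV. a i j (grad u x) * hessian u x $ i $ j)
                - b x (u x) (grad u x) = 0"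
    and M: "M = C2_norm \<Omega> u" and m: "m = Linf_norm \<Omega> u" and "\<delta> \<ge> 0" "\<beta> > 0"
    and b_mono: "\<forall>x\<in>\<Omega>. \<forall>s z. ereal \<bar>s\<bar> \<le> m \<longrightarrow> ereal (norm z) \<le> M \<longrightarrow>
         deriv (\<lambda>r. b x r z) s \<ge> \<beta>"
    and HC: "\<forall>z. ereal (norm z) \<le> M \<longrightarrow>
         (\<forall>x1\<in>\<Omega>. \<forall>x3\<in>\<Omega>. \<forall>t\<in>{0..1}.
            harmonic_convexity_defined b u z x1 x3 t \<longrightarrow>
            harmonic_convexity_fun b u z x1 x3 t \<ge> - \<delta>)"
    and "achieves_pos_interior_max \<Omega> u"
  then obtain x1 x3 t where x: "x1 \<in> \<Omega>" "x3 \<in> \<Omega>" "t \<in> {0..1}"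
    and pos: "convexity_fun u x1 x3 t > 0"
    and max: "\<forall>y1\<in>closure \<Omega>. \<forall>y3\<in>closure \<Omega>. \<forall>\<mu>\<in>{0..1}.
           convexity_fun u y1 y3 \<mu> \<le> convexity_fun u x1 x3 t"
    unfolding achieves_pos_interior_max_def by blast
  have "open \<Omega>" using dom by (simp add: is_domain_def)
  have max': "convexity_fun u y1 y3 \<mu> \<le> convexity_fun u x1 x3 t"
    if "y1 \<in> \<Omega>" "y3 \<in> \<Omega>" "\<mu> \<in> {0..1}" for y1 y3 \<mu>
    using max that closure_subset by blast
  have "convexity_fun u x1 x3 t \<le> \<delta> / \<beta>"
    using \<open>open \<Omega>\<close> \<open>convex \<Omega>\<close> u(1) _ _ _ _ \<open>\<beta> > 0\<close> _ _ x pos max'[OF _ _ x(3)]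
    by (rule max_convexity_fun_le[where a = a and b = b]) (use b A eq b_mono HC M m in auto)
  then have "convexity_fun u y1 y3 \<mu> \<le> \<delta> / \<beta>"
    if "y1 \<in> \<Omega>" "y3 \<in> \<Omega>" "\<mu> \<in> {0..1}" for y1 y3 \<mu>
    using max'[OF that] by simp
  then obtain v where v: "convex_on \<Omega> v" "\<And>x. x \<in> \<Omega> \<Longrightarrow> v x \<le> u x"
      "\<And>x. x \<in> \<Omega> \<Longrightarrow> u x \<le> v x + real (DIM(real^'n) + 2) * (\<delta> / \<beta>)"
    using Hyers_Ulam_approx_convex[of \<Omega> "\<delta> / \<beta>" u] \<open>convex \<Omega>\<close> \<open>\<delta> \<ge> 0\<close> \<open>\<beta> > 0\<close>
    by (metis divide_nonneg_pos)
  have "Linf_norm \<Omega> (\<lambda>x. u x - v x) \<le> ereal (real (DIM(real^'n) + 2) / \<beta> * \<delta>)"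
  proof (rule Linf_norm_le)
    show "continuous_on \<Omega> (\<lambda>x. u x - v x)"
      using continuous_on_subset[OF u(2) closure_subset] convex_on_continuous[OF \<open>open \<Omega>\<close> v(1)]
      by (rule continuous_on_diff)
    show "\<bar>u x - v x\<bar> \<le> real (DIM(real^'n) + 2) / \<beta> * \<delta>" if "x \<in> \<Omega>" for x
      using v(2,3)[OF that] by simp
  qed fact
  with v(1) show "\<exists>v. convex_on \<Omega> v \<and>
      Linf_norm \<Omega> (\<lambda>x. u x - v x) \<le> ereal (real (DIM(real^'n) + 2) / \<beta> * \<delta>)"
    by blast
qed simp

end
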